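(* Let $\mathcal{C}$ be either the category of Banach Abelian groups or the category of non-Archimedean Banach Abelian groups, let $R$ be a commutative monoid object of $\mathcal{C}$, let $M$ be an object of $\mathrm{Mod}_{\mathcal{C}}(R)$, and let $X$ be a topological space. If $M$ is isolated at $0$, then the pre-composition map $\mathrm{C}(\zeta(X),M) \to \mathrm{C}_{\mathrm{fin}}(X,M)$, $f \mapsto f \circ \iota_{\zeta,X}$, by the canonical map $\iota_{\zeta,X} \colon X \to \zeta(X)$ is an isometric $R$-linear isomorphism.
   Context: A complete norm on an Abelian group $M$ is a map $\|\cdot\|_M \colon M \to [0,\infty)$ such that $(m_0,m_1) \mapsto \|m_0-m_1\|_M$ is a complete metric. A Banach Abelian group is an Abelian group with a complete norm; it is non-Archimedean if the metric is an ultrametric. Morphisms are bounded group homomorphisms ($\|\phi(m)\| \le C\|m\|$ for some $C$). Both categories are symmetric monoidal for the completed tensor product (completion of $M_0\otimes_{\mathbb{Z}}M_1$ for the infimum over presentations $\sum_j m_{0,j}\otimes m_{1,j}$ of $\sum_j \|m_{0,j}\|\|m_{1,j}\|$ in the general case, of $\max_j \|m_{0,j}\|\|m_{1,j}\|$ in the non-Archimedean case). Thus a commutative monoid object $R$ is a commutative unital ring with a complete (resp. complete ultrametric) norm and bounded multiplication, $\|ab\|\le C\|a\|\|b\|$; $\mathrm{Mod}_{\mathcal{C}}(R)$ is the category of $R$-modules in $\mathcal{C}$ with bounded scalar multiplication and bounded $R$-linear homomorphisms. $M$ is isolated at $0$ if $\{0\}\subset M$ is open for the norm topology. $\mathrm{C}(X,M)$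 is the $R$-module of continuous maps $X\to M$, and $\mathrm{C}_{\mathrm{fin}}(X,M)$ the submodule of continuous maps with finite image; $\mathrm{C}_{\mathrm{fin}}(X,M)$, and $\mathrm{C}(Y,M)$ for $Y$ compact, carry the supremum norm. The Banaschewski compactification $\zeta$ is the left adjoint of the inclusion of totally disconnected compact Hausdorff spaces into topological spaces, and $\iota_{\zeta,X}\colon X\to\zeta(X)$ is the unit of the adjunction; explicitly $\zeta(X)$ is the space of ultrafilters of the Boolean algebra $\mathrm{CO}(X)$ of clopen subsets of $X$. *)

theory Defs
  imports "HOL-Algebra.Module" "HOL-Analysis.Abstract_Metric_Spaces"
begin

section \<open>Banach Abelian groups and their modules\<close>

text \<open>
  Only the additive part of the record is used for an Abelian group: as usual in HOL-Algebra, rings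
  and modules extend the ring record. The distance is set to 0 off the carrier because
  \<^const>\<open>Metric_space\<close> demands nonnegativity and symmetry on the whole type.
\<close>

definition norm_dist :: "('a, 'm) ring_scheme \<Rightarrow> ('a \<Rightarrow> real) \<Rightarrow> 'a \<Rightarrow> 'a \<Rightarrow> real" where
  "norm_dist G nrm a b =
     (if a \<in> carrier G \<and> b \<in> carrier G then nrm (a \<ominus>\<^bsub>G\<^esub> b) else 0)"

definition complete_norm :: "('a, 'm) ring_scheme \<Rightarrow> ('a \<Rightarrow> real) \<Rightarrow> bool" where
  "complete_norm G nrm \<longleftrightarrow>
     nrm \<in> carrier G \<rightarrow> {0..} \<and>
     Metric_space (carrier G) (norm_dist G nrm) \<and>
     Metric_space.mcomplete (carrier G) (norm_dist G nrm)"

definition norm_topology :: "('a, 'm) ring_scheme \<Rightarrow> ('a \<Rightarrow> real) \<Rightarrow> 'a topology" where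
  "norm_topology G nrm = Metric_space.mtopology (carrier G) (norm_dist G nrm)"

definition ultrametric_norm :: "('a, 'm) ring_scheme \<Rightarrow> ('a \<Rightarrow> real) \<Rightarrow> bool" where
  "ultrametric_norm G nrm \<longleftrightarrow>
     (\<forall>a\<in>carrier G. \<forall>b\<in>carrier G. \<forall>c\<in>carrier G.
        norm_dist G nrm a c \<le> max (norm_dist G nrm a b) (norm_dist G nrm b c))"

datatype banach_category = Ban | Ban_nonarch

definition banach_group ::
    "banach_category \<Rightarrow> ('a, 'm) ring_scheme \<Rightarrow> ('a \<Rightarrow> real) \<Rightarrow> bool" where
  "banach_group \<C> G nrm \<longleftrightarrow>
     abelian_group G \<and> complete_norm G nrm \<and> (\<C> = Ban_nonarch \<longrightarrow> ultrametric_norm G nrm)"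

text \<open>
  A commutative monoid object for the completed tensor product: the multiplication extends to the
  completed tensor product iff it is bounded as a bilinear map. The unit morphism, out of the
  integers, is automatically bounded. The zero ring is allowed.
\<close>

definition commutative_monoid_object ::
    "banach_category \<Rightarrow> ('r, 's) ring_scheme \<Rightarrow> ('r \<Rightarrow> real) \<Rightarrow> bool" where
  "commutative_monoid_object \<C> R nR \<longleftrightarrow>
     cring R \<and> banach_group \<C> R nR \<and>
     (\<exists>C. \<forall>a\<in>carrier R. \<forall>b\<in>carrier R. nR (a \<otimes>\<^bsub>R\<^esub> b) \<le> C * nR a * nR b)"

definition banach_module ::
    "banach_category \<Rightarrow> ('r, 's) ring_scheme \<Rightarrow> ('r \<Rightarrow> real) \<Rightarrow>
     ('r, 'a, 'm) module_scheme \<Rightarrow> ('a \<Rightarrow> real) \<Rightarrow> bool" where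
  "banach_module \<C> R nR M nM \<longleftrightarrow>
     Module.module R M \<and> banach_group \<C> M nM \<and>
     (\<exists>C. \<forall>r\<in>carrier R. \<forall>m\<in>carrier M. nM (r \<odot>\<^bsub>M\<^esub> m) \<le> C * nR r * nM m)"

definition isolated_at_zero :: "('a, 'm) ring_scheme \<Rightarrow> ('a \<Rightarrow> real) \<Rightarrow> bool" where
  "isolated_at_zero M nM \<longleftrightarrow> openin (norm_topology M nM) {\<zero>\<^bsub>M\<^esub>}"


section \<open>Modules of continuous maps\<close>

text \<open>
  Maps out of a space are represented by functions that are undefined off its underlying set. The
  fields \<open>mult\<close> and \<open>one\<close> of the record play no role for a module.
\<close>

definition cont_module ::
    "'x topology \<Rightarrow> ('r, 'a, 'm) module_scheme \<Rightarrow> ('a \<Rightarrow> real) \<Rightarrow> ('r, 'x \<Rightarrow> 'a) module" where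
  "cont_module X M nM =
     \<lparr>carrier = {f \<in> extensional (topspace X). continuous_map X (norm_topology M nM) f},
      mult = undefined, one = undefined,
      zero = (\<lambda>x\<in>topspace X. \<zero>\<^bsub>M\<^esub>),
      add = (\<lambda>f g. \<lambda>x\<in>topspace X. f x \<oplus>\<^bsub>M\<^esub> g x),
      smult = (\<lambda>r f. \<lambda>x\<in>topspace X. r \<odot>\<^bsub>M\<^esub> f x)\<rparr>"

definition cont_fin_module ::
    "'x topology \<Rightarrow> ('r, 'a, 'm) module_scheme \<Rightarrow> ('a \<Rightarrow> real) \<Rightarrow> ('r, 'x \<Rightarrow> 'a) module" where
  "cont_fin_module X M nM =
     (cont_module X M nM)
       \<lparr>carrier := {f \<in> carrier (cont_module X M nM). finite (f ` topspace X)}\<rparr>"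

text \<open>Continuous maps do form a module, and those with finite image a submodule.\<close>

lemma banach_module_norm_add:
  assumes "banach_module \<C> R nR M nM" "x \<in> carrier M" "y \<in> carrier M"
  shows "nM (x \<oplus>\<^bsub>M\<^esub> y) \<le> nM x + nM y"
proof -
  interpret Module.module R M using assms(1) by (simp add: banach_module_def)
  interpret Metric_space "carrier M" "norm_dist M nM"
    using assms(1) by (simp add: banach_module_def banach_group_def complete_norm_def)
  have "norm_dist M nM x (\<ominus>\<^bsub>M\<^esub> y) \<le> norm_dist M nM x \<zero>\<^bsub>M\<^esub> + norm_dist M nM \<zero>\<^bsub>M\<^esub> (\<ominus>\<^bsub>M\<^esub> y)"
    using assms by (intro triangle) auto
  moreover have "\<ominus>\<^bsub>M\<^esub> \<zero>\<^bsub>M\<^esub> = \<zero>\<^bsub>M\<^esub>" using M.r_neg[OF M.zero_closed] by simp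
  ultimately show ?thesis using assms by (simp add: norm_dist_def a_minus_def)
qed

lemma continuous_map_add:
  assumes M: "banach_module \<C> R nR M nM"
    and f: "continuous_map X (norm_topology M nM) f" and g: "continuous_map X (norm_topology M nM) g"
  shows "continuous_map X (norm_topology M nM) (\<lambda>x. f x \<oplus>\<^bsub>M\<^esub> g x)"
proof -
  interpret Module.module R M using M by (simp add: banach_module_def)
  interpret Metric_space "carrier M" "norm_dist M nM"
    using M by (simp add: banach_module_def banach_group_def complete_norm_def)
  have le: "norm_dist M nM (a \<oplus>\<^bsub>M\<^esub> b) (a' \<oplus>\<^bsub>M\<^esub> b') \<le> norm_dist M nM a a' + norm_dist M nM b b'"
    if c: "a \<in> carrier M" "b \<in> carrier M" "a' \<in> carrier M" "b' \<in> carrier M" for a b a' b'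
  proof -
    have "(a \<oplus>\<^bsub>M\<^esub> b) \<ominus>\<^bsub>M\<^esub> (a' \<oplus>\<^bsub>M\<^esub> b') = (a \<ominus>\<^bsub>M\<^esub> a') \<oplus>\<^bsub>M\<^esub> (b \<ominus>\<^bsub>M\<^esub> b')"
      using c by (simp add: a_minus_def M.minus_add M.a_ac)
    then show ?thesis
      using banach_module_norm_add[OF M, of "a \<ominus>\<^bsub>M\<^esub> a'" "b \<ominus>\<^bsub>M\<^esub> b'"] c
      by (simp add: norm_dist_def)
  qed
  show ?thesis
    unfolding norm_topology_def continuous_map_to_metric
  proof (intro ballI allI impI)
    fix x and e :: real assume x: "x \<in> topspace X" and e: "e > 0"
    obtain U where U: "openin X U" "x \<in> U" "\<forall>y\<in>U. f y \<in> mball (f x) (e/2)"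
      using f x e unfolding norm_topology_def continuous_map_to_metric by (meson half_gt_zero)
    obtain V where V: "openin X V" "x \<in> V" "\<forall>y\<in>V. g y \<in> mball (g x) (e/2)"
      using g x e unfolding norm_topology_def continuous_map_to_metric by (meson half_gt_zero)
    have "f y \<oplus>\<^bsub>M\<^esub> g y \<in> mball (f x \<oplus>\<^bsub>M\<^esub> g x) e" if "y \<in> U \<inter> V" for y
    proof -
      have "f y \<in> mball (f x) (e/2)" "g y \<in> mball (g x) (e/2)" using U V that by auto
      then show ?thesis using le[of "f x" "g x" "f y" "g y"] by simp
    qed
    then show "\<exists>U. openin X U \<and> x \<in> U \<and> (\<forall>y\<in>U. f y \<oplus>\<^bsub>M\<^esub> g y \<in> mball (f x \<oplus>\<^bsub>M\<^esub> g x) e)"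
      using U V by (intro exI[of _ "U \<inter> V"]) auto
  qed
qed

lemma continuous_map_smult:
  assumes M: "banach_module \<C> R nR M nM" and r: "r \<in> carrier R"
    and f: "continuous_map X (norm_topology M nM) f"
  shows "continuous_map X (norm_topology M nM) (\<lambda>x. r \<odot>\<^bsub>M\<^esub> f x)"
proof -
  interpret Module.module R M using M by (simp add: banach_module_def)
  interpret Metric_space "carrier M" "norm_dist M nM"
    using M by (simp add: banach_module_def banach_group_def complete_norm_def)
  obtain C where C: "\<And>m. m \<in> carrier M \<Longrightarrow> nM (r \<odot>\<^bsub>M\<^esub> m) \<le> C * nR r * nM m"
    using M r by (auto simp: banach_module_def)
  define K where "K = max 1 (C * nR r)"
  have K: "K > 0" by (simp add: K_def)
  have le: "norm_dist M nM (r \<odot>\<^bsub>M\<^esub> a) (r \<odot>\<^bsub>M\<^esub> b) \<le> K * norm_dist M nM a b"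
    if c: "a \<in> carrier M" "b \<in> carrier M" for a b
  proof -
    have "(r \<odot>\<^bsub>M\<^esub> a) \<ominus>\<^bsub>M\<^esub> (r \<odot>\<^bsub>M\<^esub> b) = r \<odot>\<^bsub>M\<^esub> (a \<ominus>\<^bsub>M\<^esub> b)"
      using c r by (simp add: a_minus_def smult_r_distr smult_r_minus)
    moreover have "nM (r \<odot>\<^bsub>M\<^esub> (a \<ominus>\<^bsub>M\<^esub> b)) \<le> C * nR r * norm_dist M nM a b"
      using C[of "a \<ominus>\<^bsub>M\<^esub> b"] c by (simp add: norm_dist_def)
    moreover have "\<dots> \<le> K * norm_dist M nM a b"
      by (intro mult_right_mono) (simp_all add: K_def)
    ultimately show ?thesis using c r by (simp add: norm_dist_def)
  qed
  show ?thesis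
    unfolding norm_topology_def continuous_map_to_metric
  proof (intro ballI allI impI)
    fix x and e :: real assume x: "x \<in> topspace X" and e: "e > 0"
    then have "e / K > 0" using K by simp
    then obtain U where U: "openin X U" "x \<in> U" "\<forall>y\<in>U. f y \<in> mball (f x) (e / K)"
      using f x unfolding norm_topology_def continuous_map_to_metric by meson
    have "r \<odot>\<^bsub>M\<^esub> f y \<in> mball (r \<odot>\<^bsub>M\<^esub> f x) e" if "y \<in> U" for y
    proof -
      have y: "f y \<in> mball (f x) (e / K)" using U that by auto
      then have "K * norm_dist M nM (f x) (f y) < e" using K by (simp add: field_simps)
      then show ?thesis using le[of "f x" "f y"] y r by simp
    qed
    then show "\<exists>U. openin X U \<and> x \<in> U \<and> (\<forall>y\<in>U. r \<odot>\<^bsub>M\<^esub> f y \<in> mball (r \<odot>\<^bsub>M\<^esub> f x) e)"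
      using U by (intro exI[of _ U]) auto
  qed
qed

lemma cont_module_eqs:
  "carrier (cont_module X M nM) =
     {f \<in> extensional (topspace X). continuous_map X (norm_topology M nM) f}"
  "f \<oplus>\<^bsub>cont_module X M nM\<^esub> g = (\<lambda>x\<in>topspace X. f x \<oplus>\<^bsub>M\<^esub> g x)"
  "\<zero>\<^bsub>cont_module X M nM\<^esub> = (\<lambda>x\<in>topspace X. \<zero>\<^bsub>M\<^esub>)"
  "r \<odot>\<^bsub>cont_module X M nM\<^esub> f = (\<lambda>x\<in>topspace X. r \<odot>\<^bsub>M\<^esub> f x)"
  by (simp_all add: cont_module_def)

lemma continuous_map_restrict_eq:
  "continuous_map X Y (\<lambda>x\<in>topspace X. f x) \<longleftrightarrow> continuous_map X Y f"
  using continuous_map_eq[of X Y f "\<lambda>x\<in>topspace X. f x"]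
    continuous_map_eq[of X Y "\<lambda>x\<in>topspace X. f x" f] by auto

lemma module_cont_module:
  assumes M: "banach_module \<C> R nR M nM"
  shows "Module.module R (cont_module X M nM)"
proof -
  interpret Module.module R M using M by (simp add: banach_module_def)
  interpret Metric_space "carrier M" "norm_dist M nM"
    using M by (simp add: banach_module_def banach_group_def complete_norm_def)
  have val: "f x \<in> carrier M" if "continuous_map X (norm_topology M nM) f" "x \<in> topspace X" for f x
    using that by (auto simp: continuous_map_def norm_topology_def)
  note simps = cont_module_eqs continuous_map_restrict_eq
  show ?thesis
  proof (rule moduleI)
    show "cring R" using M by (simp add: banach_module_def Module.module_def)
    show "abelian_group (cont_module X M nM)"
    proof (rule abelian_groupI)
      fix f assume f: "f \<in> carrier (cont_module X M nM)"
      define h where "h = (\<lambda>x\<in>topspace X. (\<ominus>\<^bsub>R\<^esub> \<one>\<^bsub>R\<^esub>) \<odot>\<^bsub>M\<^esub> f x)"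
      have "h \<in> carrier (cont_module X M nM)"
        using f continuous_map_smult[OF M, of "\<ominus>\<^bsub>R\<^esub> \<one>\<^bsub>R\<^esub>" X f] by (simp add: h_def simps)
      moreover have "h \<oplus>\<^bsub>cont_module X M nM\<^esub> f = \<zero>\<^bsub>cont_module X M nM\<^esub>"
        using f val by (auto simp: simps h_def smult_l_minus M.l_neg intro!: restrict_ext)
      ultimately show "\<exists>h\<in>carrier (cont_module X M nM). h \<oplus>\<^bsub>cont_module X M nM\<^esub> f = \<zero>\<^bsub>cont_module X M nM\<^esub>"
        by blast
    next
      fix f g assume "f \<in> carrier (cont_module X M nM)" "g \<in> carrier (cont_module X M nM)"
      then show "f \<oplus>\<^bsub>cont_module X M nM\<^esub> g \<in> carrier (cont_module X M nM)"
        using continuous_map_add[OF M, of X f g] by (simp add: simps)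
    qed (auto simp: simps norm_topology_def val[unfolded norm_topology_def] M.a_ac
        intro!: restrict_ext extensionalityI[of _ "topspace X"])
    fix r f assume "r \<in> carrier R" "f \<in> carrier (cont_module X M nM)"
    then show "r \<odot>\<^bsub>cont_module X M nM\<^esub> f \<in> carrier (cont_module X M nM)"
      using continuous_map_smult[OF M, of r X f] by (simp add: simps)
  qed (auto simp: simps val smult_l_distr smult_r_distr smult_assoc1
      intro!: restrict_ext extensionalityI[of _ "topspace X"])
qed

lemma submodule_cont_fin_module:
  assumes M: "banach_module \<C> R nR M nM"
  shows "submodule (carrier (cont_fin_module X M nM)) R (cont_module X M nM)"
proof -
  interpret C: Module.module R "cont_module X M nM" by (rule module_cont_module[OF M])
  have carr: "f \<in> carrier (cont_fin_module X M nM) \<longleftrightarrow>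
      f \<in> carrier (cont_module X M nM) \<and> finite (f ` topspace X)" for f
    by (simp add: cont_fin_module_def)
  have smult: "r \<odot>\<^bsub>cont_module X M nM\<^esub> f \<in> carrier (cont_fin_module X M nM)"
    if r: "r \<in> carrier R" and f: "f \<in> carrier (cont_fin_module X M nM)" for r f
  proof -
    have "(r \<odot>\<^bsub>cont_module X M nM\<^esub> f) ` topspace X = (\<lambda>m. r \<odot>\<^bsub>M\<^esub> m) ` f ` topspace X"
      by (auto simp: cont_module_eqs)
    then show ?thesis using r f C.smult_closed by (simp add: carr)
  qed
  show ?thesis
  proof (rule C.submoduleI)
    show "carrier (cont_fin_module X M nM) \<subseteq> carrier (cont_module X M nM)" using carr by blast
    have "\<zero>\<^bsub>cont_module X M nM\<^esub> ` topspace X \<subseteq> {\<zero>\<^bsub>M\<^esub>}" by (auto simp: cont_module_eqs)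
    then show "\<zero>\<^bsub>cont_module X M nM\<^esub> \<in> carrier (cont_fin_module X M nM)"
      using finite_subset by (auto simp: carr)
  next
    fix f assume f: "f \<in> carrier (cont_fin_module X M nM)"
    have "\<ominus>\<^bsub>cont_module X M nM\<^esub> f = (\<ominus>\<^bsub>R\<^esub> \<one>\<^bsub>R\<^esub>) \<odot>\<^bsub>cont_module X M nM\<^esub> f"
      using f by (simp add: C.smult_l_minus carr)
    then show "\<ominus>\<^bsub>cont_module X M nM\<^esub> f \<in> carrier (cont_fin_module X M nM)"
      using smult[OF _ f] by simp
  next
    fix f g assume fg: "f \<in> carrier (cont_fin_module X M nM)" "g \<in> carrier (cont_fin_module X M nM)"
    have "(f \<oplus>\<^bsub>cont_module X M nM\<^esub> g) ` topspace X \<subseteq>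
        (\<lambda>(a, b). a \<oplus>\<^bsub>M\<^esub> b) ` (f ` topspace X \<times> g ` topspace X)"
      by (auto simp: cont_module_eqs)
    then have "finite ((f \<oplus>\<^bsub>cont_module X M nM\<^esub> g) ` topspace X)"
      using fg by (rule_tac finite_subset) (auto simp: carr)
    then show "f \<oplus>\<^bsub>cont_module X M nM\<^esub> g \<in> carrier (cont_fin_module X M nM)"
      using fg by (simp add: carr)
  qed (rule smult)
qed

text \<open>The element 0 is inserted so that the supremum over the empty space is 0; norms being
  nonnegative, it is harmless otherwise.\<close>

definition sup_norm :: "'x topology \<Rightarrow> ('a \<Rightarrow> real) \<Rightarrow> ('x \<Rightarrow> 'a) \<Rightarrow> real" where
  "sup_norm X nM f = Sup (insert 0 ((\<lambda>x. nM (f x)) ` topspace X))"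

definition linear_maps ::
    "('r, 's) ring_scheme \<Rightarrow> ('r, 'a, 'm) module_scheme \<Rightarrow> ('r, 'b, 'n) module_scheme \<Rightarrow>
     ('a \<Rightarrow> 'b) set" where
  "linear_maps R M N =
     {h \<in> carrier M \<rightarrow> carrier N.
        (\<forall>x\<in>carrier M. \<forall>y\<in>carrier M. h (x \<oplus>\<^bsub>M\<^esub> y) = h x \<oplus>\<^bsub>N\<^esub> h y) \<and>
        (\<forall>r\<in>carrier R. \<forall>x\<in>carrier M. h (r \<odot>\<^bsub>M\<^esub> x) = r \<odot>\<^bsub>N\<^esub> h x)}"

definition isometric_linear_isos ::
    "('r, 's) ring_scheme \<Rightarrow> ('r, 'a, 'm) module_scheme \<Rightarrow> ('a \<Rightarrow> real) \<Rightarrow>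
     ('r, 'b, 'n) module_scheme \<Rightarrow> ('b \<Rightarrow> real) \<Rightarrow> ('a \<Rightarrow> 'b) set" where
  "isometric_linear_isos R M nM N nN =
     {h \<in> linear_maps R M N. bij_betw h (carrier M) (carrier N) \<and>
        (\<forall>x\<in>carrier M. nN (h x) = nM x)}"


section \<open>The Banaschewski compactification\<close>

definition clopens :: "'x topology \<Rightarrow> 'x set set" where
  "clopens X = {A. openin X A \<and> closedin X A}"

definition clopen_ultrafilters :: "'x topology \<Rightarrow> 'x set set set" where
  "clopen_ultrafilters X =
     {\<U>. \<U> \<subseteq> clopens X \<and> topspace X \<in> \<U> \<and> {} \<notin> \<U> \<and>
         (\<forall>A\<in>\<U>. \<forall>B\<in>\<U>. A \<inter> B \<in> \<U>) \<and>
         (\<forall>A\<in>\<U>. \<forall>B\<in>clopens X. A \<subseteq> B \<longrightarrow> B \<in> \<U>) \<and>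
         (\<forall>A\<in>clopens X. A \<in> \<U> \<or> topspace X - A \<in> \<U>)}"

definition banaschewski :: "'x topology \<Rightarrow> 'x set set topology" (\<open>\<zeta>\<close>) where
  "\<zeta> X = topology_generated_by ((\<lambda>A. {\<U> \<in> clopen_ultrafilters X. A \<in> \<U>}) ` clopens X)"

definition banaschewski_unit :: "'x topology \<Rightarrow> 'x \<Rightarrow> 'x set set" (\<open>\<iota>\<^sub>\<zeta>\<close>) where
  "\<iota>\<^sub>\<zeta> X x = {A \<in> clopens X. x \<in> A}"

definition banaschewski_pullback :: "'x topology \<Rightarrow> ('x set set \<Rightarrow> 'a) \<Rightarrow> ('x \<Rightarrow> 'a)" where
  "banaschewski_pullback X f = (\<lambda>x\<in>topspace X. f (\<iota>\<^sub>\<zeta> X x))"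

text \<open>The ultrafilter description is the left adjoint of the inclusion of totally disconnected
  compact Hausdorff spaces, with unit \<open>\<iota>\<^sub>\<zeta> X\<close>.\<close>

definition totally_disconnected_space :: "'x topology \<Rightarrow> bool" where
  "totally_disconnected_space Y \<longleftrightarrow> (\<forall>S. connectedin Y S \<longrightarrow> (\<exists>y. S \<subseteq> {y}))"

lemma clopensD:
  assumes "A \<in> clopens X" shows "openin X A" "closedin X A" "A \<subseteq> topspace X"
  using assms by (auto simp: clopens_def closedin_subset)

lemma clopens_topspace [simp]: "topspace X \<in> clopens X"
  and clopens_empty [simp]: "{} \<in> clopens X"
  by (auto simp: clopens_def)

lemma clopens_Int: "A \<in> clopens X \<Longrightarrow> B \<in> clopens X \<Longrightarrow> A \<inter> B \<in> clopens X"
  and clopens_compl: "A \<in> clopens X \<Longrightarrow> topspace X - A \<in> clopens X"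
  by (auto simp: clopens_def openin_diff closedin_diff)

lemma ultrafilterD:
  assumes "\<U> \<in> clopen_ultrafilters X"
  shows "\<U> \<subseteq> clopens X" "topspace X \<in> \<U>" "{} \<notin> \<U>"
    "\<And>A B. A \<in> \<U> \<Longrightarrow> B \<in> \<U> \<Longrightarrow> A \<inter> B \<in> \<U>"
    "\<And>A B. A \<in> \<U> \<Longrightarrow> B \<in> clopens X \<Longrightarrow> A \<subseteq> B \<Longrightarrow> B \<in> \<U>"
    "\<And>A. A \<in> clopens X \<Longrightarrow> topspace X - A \<in> \<U> \<longleftrightarrow> A \<notin> \<U>"
proof -
  show "\<And>A. A \<in> clopens X \<Longrightarrow> topspace X - A \<in> \<U> \<longleftrightarrow> A \<notin> \<U>"
  proof -
    fix A assume A: "A \<in> clopens X"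
    have "(topspace X - A) \<inter> A = {}" by blast
    then show "topspace X - A \<in> \<U> \<longleftrightarrow> A \<notin> \<U>"
      using assms A unfolding clopen_ultrafilters_def by (smt (verit) mem_Collect_eq)
  qed
qed (use assms in \<open>auto simp: clopen_ultrafilters_def\<close>)

lemma ultrafilter_Inter:
  assumes "\<U> \<in> clopen_ultrafilters X" "finite \<E>" "\<E> \<subseteq> \<U>"
  shows "topspace X \<inter> \<Inter>\<E> \<in> \<U>"
  using assms(2,3)
proof (induction \<E>)
  case empty
  then show ?case using ultrafilterD(2)[OF assms(1)] by simp
next
  case (insert A \<E>)
  have "topspace X \<inter> \<Inter>(insert A \<E>) = A \<inter> (topspace X \<inter> \<Inter>\<E>)" by blast
  then show ?case using ultrafilterD(4)[OF assms(1)] insert by simp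
qed

lemma ultrafilter_exists:
  assumes sub: "\<F> \<subseteq> clopens X"
    and fip: "\<And>\<E>. finite \<E> \<Longrightarrow> \<E> \<subseteq> \<F> \<Longrightarrow> topspace X \<inter> \<Inter>\<E> \<noteq> {}"
  obtains \<U> where "\<U> \<in> clopen_ultrafilters X" "\<F> \<subseteq> \<U>"
proof -
  define P where "P \<G> \<longleftrightarrow> \<F> \<subseteq> \<G> \<and> \<G> \<subseteq> clopens X \<and>
      (\<forall>\<E>. finite \<E> \<longrightarrow> \<E> \<subseteq> \<G> \<longrightarrow> topspace X \<inter> \<Inter>\<E> \<noteq> {})" for \<G>
  have "\<exists>\<U>\<in>Collect P. \<forall>\<V>\<in>Collect P. \<U> \<subseteq> \<V> \<longrightarrow> \<V> = \<U>"
  proof (rule subset_Zorn_nonempty)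
    show "Collect P \<noteq> {}" using sub fip by (auto simp: P_def)
  next
    fix \<C> assume ne: "\<C> \<noteq> {}" and ch: "subset.chain (Collect P) \<C>"
    then have P: "P \<G>" if "\<G> \<in> \<C>" for \<G>
      using that by (auto simp: subset_chain_def)
    have "topspace X \<inter> \<Inter>\<E> \<noteq> {}" if E: "finite \<E>" "\<E> \<subseteq> \<Union>\<C>" for \<E>
    proof -
      obtain \<G> where "\<G> \<in> \<C>" "\<E> \<subseteq> \<G>"
        using finite_subset_Union_chain[OF E ne ch] by blast
      then show ?thesis using P[of \<G>] E(1) by (auto simp: P_def)
    qed
    moreover have "\<F> \<subseteq> \<Union>\<C>" "\<Union>\<C> \<subseteq> clopens X"
      using ne P unfolding P_def by blast+
    ultimately show "\<Union>\<C> \<in> Collect P" by (simp add: P_def)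
  qed
  then obtain \<U> where PU: "P \<U>" and max: "\<And>\<V>. P \<V> \<Longrightarrow> \<U> \<subseteq> \<V> \<Longrightarrow> \<V> = \<U>" by blast
  then have U: "\<F> \<subseteq> \<U>" "\<U> \<subseteq> clopens X"
    and fipU: "\<And>\<E>. finite \<E> \<Longrightarrow> \<E> \<subseteq> \<U> \<Longrightarrow> topspace X \<inter> \<Inter>\<E> \<noteq> {}"
    by (auto simp: P_def)
  have key: "\<exists>\<E>. finite \<E> \<and> \<E> \<subseteq> \<U> \<and> topspace X \<inter> A \<inter> \<Inter>\<E> = {}"
    if A: "A \<in> clopens X" "A \<notin> \<U>" for A
  proof -
    have "\<not> P (insert A \<U>)" using max[of "insert A \<U>"] A(2) by blast
    then obtain \<E> where E: "finite \<E>" "\<E> \<subseteq> insert A \<U>" "topspace X \<inter> \<Inter>\<E> = {}"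
      using U A by (auto simp: P_def)
    have "finite (\<E> - {A})" "\<E> - {A} \<subseteq> \<U>" "topspace X \<inter> A \<inter> \<Inter>(\<E> - {A}) = {}"
      using E by auto
    then show ?thesis by blast
  qed
  have "\<U> \<in> clopen_ultrafilters X"
    unfolding clopen_ultrafilters_def
  proof (intro CollectI conjI ballI impI)
    show "topspace X \<in> \<U>"
      using key[of "topspace X"] fipU by (metis clopens_topspace inf.idem)
    show "{} \<notin> \<U>" using fipU[of "{{}}"] by auto
  next
    fix A B assume AB: "A \<in> \<U>" "B \<in> \<U>"
    show "A \<inter> B \<in> \<U>"
    proof (rule ccontr)
      assume "A \<inter> B \<notin> \<U>"
      then obtain \<E> where "finite \<E>" "\<E> \<subseteq> \<U>" "topspace X \<inter> (A \<inter> B) \<inter> \<Inter>\<E> = {}"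
        using key[OF clopens_Int] AB U(2) by (meson subsetD)
      then show False using fipU[of "insert A (insert B \<E>)"] AB by auto
    qed
  next
    fix A B assume AB: "A \<in> \<U>" "B \<in> clopens X" "A \<subseteq> B"
    show "B \<in> \<U>"
    proof (rule ccontr)
      assume "B \<notin> \<U>"
      then obtain \<E> where "finite \<E>" "\<E> \<subseteq> \<U>" "topspace X \<inter> B \<inter> \<Inter>\<E> = {}"
        using key[OF AB(2)] by metis
      then show False using fipU[of "insert A \<E>"] AB by auto
    qed
  next
    fix A assume A: "A \<in> clopens X"
    show "A \<in> \<U> \<or> topspace X - A \<in> \<U>"
    proof (rule ccontr)
      assume "\<not> (A \<in> \<U> \<or> topspace X - A \<in> \<U>)"
      then obtain \<D> \<E> where "finite \<D>" "\<D> \<subseteq> \<U>" "topspace X \<inter> A \<inter> \<Inter>\<D> = {}"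
        "finite \<E>" "\<E> \<subseteq> \<U>" "topspace X \<inter> (topspace X - A) \<inter> \<Inter>\<E> = {}"
        using key[OF A] key[OF clopens_compl[OF A]] by metis
      then have "finite (\<D> \<union> \<E>)" "\<D> \<union> \<E> \<subseteq> \<U>" "topspace X \<inter> \<Inter>(\<D> \<union> \<E>) = {}"
        by blast+
      then show False using fipU by blast
    qed
  qed (use U in auto)
  with U that show thesis by blast
qed

lemma topspace_banaschewski: "topspace (\<zeta> X) = clopen_ultrafilters X"
  using ultrafilterD(2) by (fastforce simp: banaschewski_def)

lemma openin_banaschewski_basic:
  "A \<in> clopens X \<Longrightarrow> openin (\<zeta> X) {\<U> \<in> clopen_ultrafilters X. A \<in> \<U>}"
  unfolding banaschewski_def by (rule topology_generated_by_Basis) blast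

lemma openin_banaschewski_nhd:
  assumes "openin (\<zeta> X) W" "\<U> \<in> W"
  obtains A where "A \<in> \<U>" "{\<V> \<in> clopen_ultrafilters X. A \<in> \<V>} \<subseteq> W"
proof -
  have u: "\<U> \<in> clopen_ultrafilters X"
    using openin_subset[OF assms(1)] assms(2) by (auto simp: topspace_banaschewski)
  have "generate_topology_on ((\<lambda>A. {\<U> \<in> clopen_ultrafilters X. A \<in> \<U>}) ` clopens X) W"
    using assms(1) unfolding banaschewski_def by (rule openin_topology_generated_by)
  then have "\<U> \<in> W \<longrightarrow> (\<exists>A\<in>\<U>. {\<V> \<in> clopen_ultrafilters X. A \<in> \<V>} \<subseteq> W)"
  proof induction
    case (Int V W)
    show ?case
    proof
      assume "\<U> \<in> V \<inter> W"
      with Int.IH obtain A B where A: "A \<in> \<U>" "{\<V> \<in> clopen_ultrafilters X. A \<in> \<V>} \<subseteq> V"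
        and B: "B \<in> \<U>" "{\<V> \<in> clopen_ultrafilters X. B \<in> \<V>} \<subseteq> W"
        by auto
      have c: "A \<in> clopens X" "B \<in> clopens X"
        using ultrafilterD(1)[OF u] A(1) B(1) by auto
      have "{\<V> \<in> clopen_ultrafilters X. A \<inter> B \<in> \<V>} \<subseteq> V \<inter> W"
      proof
        fix \<V> assume v: "\<V> \<in> {\<V> \<in> clopen_ultrafilters X. A \<inter> B \<in> \<V>}"
        have "A \<in> \<V>" "B \<in> \<V>"
          using v c ultrafilterD(5)[of \<V> X "A \<inter> B" A] ultrafilterD(5)[of \<V> X "A \<inter> B" B] by auto
        with A(2) B(2) v show "\<V> \<in> V \<inter> W" by auto
      qed
      then show "\<exists>C\<in>\<U>. {\<V> \<in> clopen_ultrafilters X. C \<in> \<V>} \<subseteq> V \<inter> W"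
        using ultrafilterD(4)[OF u A(1) B(1)] by (intro bexI)
    qed
  next
    case (UN K)
    show ?case
    proof
      assume "\<U> \<in> \<Union>K"
      then obtain k where k: "k \<in> K" "\<U> \<in> k" by (elim UnionE)
      with UN.IH obtain A where "A \<in> \<U>" "{\<V> \<in> clopen_ultrafilters X. A \<in> \<V>} \<subseteq> k" by auto
      with k(1) show "\<exists>A\<in>\<U>. {\<V> \<in> clopen_ultrafilters X. A \<in> \<V>} \<subseteq> \<Union>K"
        by (intro bexI[of _ A]) auto
    qed
  qed auto
  with assms(2) that show thesis by auto
qed

lemma compact_banaschewski: "compact_space (\<zeta> X)"
  unfolding compact_space_alt
proof (intro allI impI, elim conjE)
  fix \<W> assume op: "\<forall>W\<in>\<W>. openin (\<zeta> X) W" and cov: "topspace (\<zeta> X) \<subseteq> \<Union>\<W>"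
  define \<G> where "\<G> = {A \<in> clopens X. \<exists>W\<in>\<W>. {\<V> \<in> clopen_ultrafilters X. A \<in> \<V>} \<subseteq> W}"
  show "\<exists>\<F>. finite \<F> \<and> \<F> \<subseteq> \<W> \<and> topspace (\<zeta> X) \<subseteq> \<Union>\<F>"
  proof (rule ccontr)
    assume no: "\<not> ?thesis"
    have "topspace X \<inter> \<Inter>\<E> \<noteq> {}" if E: "finite \<E>" "\<E> \<subseteq> (\<lambda>A. topspace X - A) ` \<G>" for \<E>
    proof
      assume empty: "topspace X \<inter> \<Inter>\<E> = {}"
      obtain \<D> where D: "finite \<D>" "\<D> \<subseteq> \<G>" "\<E> = (\<lambda>A. topspace X - A) ` \<D>"
        using finite_subset_image[OF E] by blast
      have "\<forall>A\<in>\<D>. \<exists>W. W \<in> \<W> \<and> {\<V> \<in> clopen_ultrafilters X. A \<in> \<V>} \<subseteq> W"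
        using D(2) by (auto simp: \<G>_def)
      from bchoice[OF this] obtain w where w: "\<forall>A\<in>\<D>. w A \<in> \<W> \<and> {\<V> \<in> clopen_ultrafilters X. A \<in> \<V>} \<subseteq> w A"
        by (elim exE)
      have "topspace (\<zeta> X) \<subseteq> \<Union>(w ` \<D>)"
      proof
        fix \<U> assume "\<U> \<in> topspace (\<zeta> X)"
        then have u: "\<U> \<in> clopen_ultrafilters X" by (simp add: topspace_banaschewski)
        have "\<exists>A\<in>\<D>. A \<in> \<U>"
        proof (rule ccontr)
          assume "\<not> ?thesis"
          then have "\<E> \<subseteq> \<U>" using D ultrafilterD(6)[OF u] by (auto simp: \<G>_def)
          then show False
            using ultrafilter_Inter[OF u E(1)] empty ultrafilterD(3)[OF u] by simp
        qed
        then show "\<U> \<in> \<Union>(w ` \<D>)" using w u by blast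
      qed
      moreover have "finite (w ` \<D>)" "w ` \<D> \<subseteq> \<W>" using D(1) w by auto
      ultimately show False using no by blast
    qed
    moreover have "(\<lambda>A. topspace X - A) ` \<G> \<subseteq> clopens X"
      using clopens_compl by (auto simp: \<G>_def)
    ultimately obtain \<U> where u: "\<U> \<in> clopen_ultrafilters X" "(\<lambda>A. topspace X - A) ` \<G> \<subseteq> \<U>"
      using ultrafilter_exists by metis
    then obtain W where W: "W \<in> \<W>" "\<U> \<in> W" using cov by (auto simp: topspace_banaschewski)
    then obtain A where A: "A \<in> \<U>" "{\<V> \<in> clopen_ultrafilters X. A \<in> \<V>} \<subseteq> W"
      using op openin_banaschewski_nhd by metis
    then have "A \<in> \<G>" using W(1) ultrafilterD(1)[OF u(1)] by (auto simp: \<G>_def)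
    then show False using u A ultrafilterD(6)[OF u(1)] ultrafilterD(1)[OF u(1)] by blast
  qed
qed

lemma banaschewski_separation:
  assumes "\<U> \<in> clopen_ultrafilters X" "\<V> \<in> clopen_ultrafilters X" "\<U> \<noteq> \<V>"
  obtains A where "A \<in> clopens X" "A \<in> \<U>" "A \<notin> \<V>"
proof -
  have "\<not> \<U> \<subseteq> \<V>"
  proof
    assume "\<U> \<subseteq> \<V>"
    then obtain A where A: "A \<in> \<V>" "A \<notin> \<U>" using assms(3) by (metis subsetI subset_antisym)
    then have "A \<in> clopens X" using ultrafilterD(1)[OF assms(2)] by blast
    then have "topspace X - A \<in> \<V>"
      using ultrafilterD(6)[OF assms(1)] A(2) \<open>\<U> \<subseteq> \<V>\<close> by (metis subsetD)
    then show False using ultrafilterD(6)[OF assms(2) \<open>A \<in> clopens X\<close>] A(1) by simp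
  qed
  then obtain A where "A \<in> \<U>" "A \<notin> \<V>" by (metis subsetI)
  with that show thesis using ultrafilterD(1)[OF assms(1)] by (metis subsetD)
qed

lemma closedin_banaschewski_basic:
  assumes "A \<in> clopens X"
  shows "closedin (\<zeta> X) {\<U> \<in> clopen_ultrafilters X. A \<in> \<U>}"
proof -
  have "topspace (\<zeta> X) - {\<U> \<in> clopen_ultrafilters X. A \<in> \<U>} =
      {\<U> \<in> clopen_ultrafilters X. topspace X - A \<in> \<U>}"
    using ultrafilterD(6) assms by (auto simp: topspace_banaschewski)
  then show ?thesis
    using openin_banaschewski_basic[OF clopens_compl[OF assms]]
    by (auto simp: closedin_def topspace_banaschewski)
qed

lemma Hausdorff_banaschewski: "Hausdorff_space (\<zeta> X)"
  unfolding Hausdorff_space_def topspace_banaschewski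
proof (intro allI impI, elim conjE)
  fix \<U> \<V> assume uv: "\<U> \<in> clopen_ultrafilters X" "\<V> \<in> clopen_ultrafilters X" "\<U> \<noteq> \<V>"
  then obtain A where A: "A \<in> clopens X" "A \<in> \<U>" "A \<notin> \<V>"
    using banaschewski_separation by metis
  have "disjnt {\<U> \<in> clopen_ultrafilters X. A \<in> \<U>} {\<U> \<in> clopen_ultrafilters X. topspace X - A \<in> \<U>}"
    using ultrafilterD(6) A(1) by (auto simp: disjnt_iff)
  moreover have "\<V> \<in> {\<U> \<in> clopen_ultrafilters X. topspace X - A \<in> \<U>}"
    using ultrafilterD(6)[OF uv(2) A(1)] A(3) uv(2) by simp
  ultimately show "\<exists>U V. openin (\<zeta> X) U \<and> openin (\<zeta> X) V \<and> \<U> \<in> U \<and> \<V> \<in> V \<and> disjnt U V"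
    using openin_banaschewski_basic[OF A(1)] openin_banaschewski_basic[OF clopens_compl[OF A(1)]]
      A(2) uv(1)
    by (intro exI[of _ "{\<U> \<in> clopen_ultrafilters X. A \<in> \<U>}"]
        exI[of _ "{\<U> \<in> clopen_ultrafilters X. topspace X - A \<in> \<U>}"] conjI) auto
qed

lemma totally_disconnected_banaschewski: "totally_disconnected_space (\<zeta> X)"
  unfolding totally_disconnected_space_def
proof (intro allI impI, rule ccontr)
  fix S assume S: "connectedin (\<zeta> X) S" and no: "\<nexists>\<U>. S \<subseteq> {\<U>}"
  then obtain \<U> \<V> where uv: "\<U> \<in> S" "\<V> \<in> S" "\<U> \<noteq> \<V>" by blast
  have sub: "S \<subseteq> clopen_ultrafilters X"
    using connectedin_subset_topspace[OF S] by (simp add: topspace_banaschewski)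
  with uv obtain A where A: "A \<in> clopens X" "A \<in> \<U>" "A \<notin> \<V>"
    using banaschewski_separation by (metis subsetD)
  show False
    using connectedin_clopen_cases[OF S closedin_banaschewski_basic openin_banaschewski_basic, OF A(1) A(1)]
      uv A sub by (auto simp: disjnt_iff)
qed

lemma banaschewski_unit_in:
  "x \<in> topspace X \<Longrightarrow> \<iota>\<^sub>\<zeta> X x \<in> clopen_ultrafilters X"
  by (auto simp: clopen_ultrafilters_def banaschewski_unit_def clopens_Int clopens_compl)

lemma continuous_map_banaschewski_unit: "continuous_map X (\<zeta> X) (\<iota>\<^sub>\<zeta> X)"
  unfolding banaschewski_def
proof (rule continuous_on_generated_topo)
  show "\<iota>\<^sub>\<zeta> X ` topspace X \<subseteq> \<Union> ((\<lambda>A. {\<U> \<in> clopen_ultrafilters X. A \<in> \<U>}) ` clopens X)"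
  proof (rule image_subsetI)
    fix x assume "x \<in> topspace X"
    from banaschewski_unit_in[OF this]
    show "\<iota>\<^sub>\<zeta> X x \<in> \<Union> ((\<lambda>A. {\<U> \<in> clopen_ultrafilters X. A \<in> \<U>}) ` clopens X)"
      using ultrafilterD(2) by (intro UN_I[OF clopens_topspace]) simp
  qed
next
  fix U assume "U \<in> (\<lambda>A. {\<U> \<in> clopen_ultrafilters X. A \<in> \<U>}) ` clopens X"
  then obtain A where A: "A \<in> clopens X" "U = {\<U> \<in> clopen_ultrafilters X. A \<in> \<U>}" by blast
  have "\<iota>\<^sub>\<zeta> X -` U \<inter> topspace X = A"
    using A banaschewski_unit_in[of _ X] clopensD(3)[OF A(1)]
    by (auto simp: banaschewski_unit_def)
  then show "openin X (\<iota>\<^sub>\<zeta> X -` U \<inter> topspace X)" using clopensD(1)[OF A(1)] by simp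
qed

lemma banaschewski_unit_dense: "\<zeta> X closure_of (\<iota>\<^sub>\<zeta> X ` topspace X) = topspace (\<zeta> X)"
proof (rule antisym[OF closure_of_subset_topspace], rule subsetI)
  fix \<U> assume U: "\<U> \<in> topspace (\<zeta> X)"
  show "\<U> \<in> \<zeta> X closure_of (\<iota>\<^sub>\<zeta> X ` topspace X)"
    unfolding in_closure_of
  proof (intro conjI U allI impI, elim conjE)
    fix W assume W: "\<U> \<in> W" "openin (\<zeta> X) W"
    then obtain A where A: "A \<in> \<U>" "{\<V> \<in> clopen_ultrafilters X. A \<in> \<V>} \<subseteq> W"
      using openin_banaschewski_nhd by metis
    have u: "\<U> \<in> clopen_ultrafilters X" using U by (simp add: topspace_banaschewski)
    then have c: "A \<in> clopens X" "A \<noteq> {}" using A(1) ultrafilterD(1,3) by blast+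
    then obtain x where x: "x \<in> A" "x \<in> topspace X" using clopensD(3) by fastforce
    then have "\<iota>\<^sub>\<zeta> X x \<in> W" using A(2) banaschewski_unit_in[of x X] c(1)
      by (auto simp: banaschewski_unit_def)
    then show "\<exists>y. y \<in> \<iota>\<^sub>\<zeta> X ` topspace X \<and> y \<in> W" using x(2) by blast
  qed
qed

lemma clopen_separation:
  assumes "compact_space Y" "Hausdorff_space Y" "totally_disconnected_space Y"
    and "y \<in> topspace Y" "z \<in> topspace Y" "y \<noteq> z"
  obtains C where "C \<in> clopens Y" "y \<in> C" "z \<notin> C"
proof -
  have "quasi_component_of Y y = connected_component_of Y y"
    using assms(1,2) by (intro quasi_eq_connected_component_of) blast
  moreover have "\<not> connected_component_of Y y z"
    using assms(3,6) unfolding connected_component_of_def totally_disconnected_space_def by blast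
  ultimately have "\<not> quasi_component_of Y y z" by simp
  then show thesis using that assms(4,5) by (auto simp: quasi_component_of clopens_def)
qed

lemma clopen_nhd:
  assumes Y: "compact_space Y" "Hausdorff_space Y" "totally_disconnected_space Y"
    and V: "openin Y V" "y \<in> V"
  obtains C where "C \<in> clopens Y" "y \<in> C" "C \<subseteq> V"
proof -
  have yY: "y \<in> topspace Y" using V openin_subset by blast
  define \<K> where "\<K> = {D \<in> clopens Y. y \<notin> D}"
  have cpt: "compactin Y (topspace Y - V)"
    using Y(1) V(1) by (intro closedin_compact_space) (auto simp: closedin_diff)
  have "topspace Y - V \<subseteq> \<Union>\<K>"
  proof
    fix z assume "z \<in> topspace Y - V"
    then obtain C where "C \<in> clopens Y" "y \<in> C" "z \<notin> C" "z \<in> topspace Y"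
      using clopen_separation[OF Y yY, of z] V(2) by blast
    then show "z \<in> \<Union>\<K>" using clopens_compl[of C Y] by (auto simp: \<K>_def)
  qed
  moreover have "\<forall>D\<in>\<K>. openin Y D" by (auto simp: \<K>_def clopens_def)
  ultimately obtain \<F> where F: "finite \<F>" "\<F> \<subseteq> \<K>" "topspace Y - V \<subseteq> \<Union>\<F>"
    using cpt unfolding compactin_def by meson
  have "\<forall>D\<in>\<F>. openin Y D \<and> closedin Y D" using F(2) by (auto simp: \<K>_def clopens_def)
  then have "\<Union>\<F> \<in> clopens Y"
    using F(1) by (simp add: clopens_def closedin_Union openin_Union)
  from clopens_compl[OF this] show thesis
  proof (rule that)
    show "y \<in> topspace Y - \<Union>\<F>" using F(2) yY by (auto simp: \<K>_def)
    show "topspace Y - \<Union>\<F> \<subseteq> V" using F(3) by blast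
  qed
qed

theorem banaschewski_universal:
  assumes Y: "compact_space Y" "Hausdorff_space Y" "totally_disconnected_space Y"
    and f: "continuous_map X Y f"
  shows "\<exists>!g. g \<in> extensional (topspace (\<zeta> X)) \<and> continuous_map (\<zeta> X) Y g \<and>
           (\<forall>x\<in>topspace X. g (\<iota>\<^sub>\<zeta> X x) = f x)"
proof -
  define pre where "pre C = {x \<in> topspace X. f x \<in> C}" for C
  have pre: "pre C \<in> clopens X" if "C \<in> clopens Y" for C
    using that f openin_continuous_map_preimage closedin_continuous_map_preimage
    unfolding pre_def clopens_def by blast
  have ex: "\<exists>y\<in>topspace Y. \<forall>C\<in>clopens Y. pre C \<in> \<U> \<longrightarrow> y \<in> C"
    if u: "\<U> \<in> clopen_ultrafilters X" for \<U>
  proof (rule ccontr)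
    assume no: "\<not> ?thesis"
    define \<K> where "\<K> = {D \<in> clopens Y. pre D \<notin> \<U>}"
    have compl: "pre (topspace Y - C) = topspace X - pre C" for C
      using f by (auto simp: pre_def continuous_map_def)
    have "topspace Y \<subseteq> \<Union>\<K>"
    proof
      fix y assume "y \<in> topspace Y"
      with no obtain C where C: "C \<in> clopens Y" "pre C \<in> \<U>" "y \<notin> C" "y \<in> topspace Y" by blast
      then have "topspace Y - C \<in> \<K>"
        using ultrafilterD(6)[OF u pre[OF C(1)]] clopens_compl by (auto simp: \<K>_def compl)
      with C show "y \<in> \<Union>\<K>" by blast
    qed
    moreover have "\<forall>D\<in>\<K>. openin Y D" by (auto simp: \<K>_def clopens_def)
    ultimately obtain \<F> where F: "finite \<F>" "\<F> \<subseteq> \<K>" "topspace Y \<subseteq> \<Union>\<F>"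
      using Y(1) unfolding compact_space_alt by meson
    have "topspace X - pre D \<in> \<U>" if "D \<in> \<F>" for D
      using that F(2) ultrafilterD(6)[OF u pre] by (auto simp: \<K>_def)
    then have "(\<lambda>D. topspace X - pre D) ` \<F> \<subseteq> \<U>" by (rule image_subsetI)
    then have "topspace X \<inter> \<Inter>((\<lambda>D. topspace X - pre D) ` \<F>) \<in> \<U>"
      by (intro ultrafilter_Inter[OF u] finite_imageI F(1))
    moreover have "topspace X \<inter> \<Inter>((\<lambda>D. topspace X - pre D) ` \<F>) = {}"
    proof (intro equals0I)
      fix x assume x: "x \<in> topspace X \<inter> \<Inter>((\<lambda>D. topspace X - pre D) ` \<F>)"
      then have "f x \<in> topspace Y" using f by (auto simp: continuous_map_def)
      then obtain D where "D \<in> \<F>" "f x \<in> D" using F(3) by auto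
      moreover from x \<open>D \<in> \<F>\<close> have "x \<in> topspace X - pre D" by (simp del: INT_simps)
      ultimately show False by (simp add: pre_def)
    qed
    ultimately show False using ultrafilterD(3)[OF u] by simp
  qed
  define g where "g = (\<lambda>\<U>\<in>topspace (\<zeta> X). SOME y. y \<in> topspace Y \<and> (\<forall>C\<in>clopens Y. pre C \<in> \<U> \<longrightarrow> y \<in> C))"
  have "g \<U> \<in> topspace Y \<and> (\<forall>C\<in>clopens Y. pre C \<in> \<U> \<longrightarrow> g \<U> \<in> C)"
    if "\<U> \<in> clopen_ultrafilters X" for \<U>
    using someI_ex[OF ex[OF that, unfolded Bex_def]] that
    by (simp add: g_def topspace_banaschewski)
  then have g: "g \<U> \<in> topspace Y" "\<And>C. C \<in> clopens Y \<Longrightarrow> pre C \<in> \<U> \<Longrightarrow> g \<U> \<in> C"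
    if "\<U> \<in> clopen_ultrafilters X" for \<U>
    using that by auto
  have gi: "pre C \<in> \<U>" if "\<U> \<in> clopen_ultrafilters X" "C \<in> clopens Y" "g \<U> \<in> C" for \<U> C
  proof (rule ccontr)
    assume "pre C \<notin> \<U>"
    then have "topspace X - pre C \<in> \<U>" using ultrafilterD(6)[OF that(1) pre[OF that(2)]] by simp
    moreover have "topspace X - pre C = pre (topspace Y - C)"
      using f by (auto simp: pre_def continuous_map_def)
    ultimately have "g \<U> \<in> topspace Y - C"
      using g(2)[OF that(1) clopens_compl[OF that(2)]] by simp
    with that show False by simp
  qed
  have cont: "continuous_map (\<zeta> X) Y g"
    unfolding continuous_map_eq_topcontinuous_at topcontinuous_at_def topspace_banaschewski
  proof (intro ballI conjI allI impI)
    show "g \<in> clopen_ultrafilters X \<rightarrow> topspace Y" if "\<U> \<in> clopen_ultrafilters X" for \<U>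
      using g(1) by (rule Pi_I)
    fix \<U> assume u: "\<U> \<in> clopen_ultrafilters X"
    then show "\<U> \<in> clopen_ultrafilters X" .
    fix V assume V: "openin Y V \<and> g \<U> \<in> V"
    then obtain C where C: "C \<in> clopens Y" "g \<U> \<in> C" "C \<subseteq> V" using clopen_nhd[OF Y] by metis
    have "\<forall>\<V>\<in>{\<V> \<in> clopen_ultrafilters X. pre C \<in> \<V>}. g \<V> \<in> V"
      using g(2)[OF _ C(1)] C(3) by auto
    moreover have "\<U> \<in> {\<V> \<in> clopen_ultrafilters X. pre C \<in> \<V>}" using gi[OF u C(1,2)] u by simp
    ultimately show "\<exists>U. openin (\<zeta> X) U \<and> \<U> \<in> U \<and> (\<forall>\<V>\<in>U. g \<V> \<in> V)"
      using openin_banaschewski_basic[OF pre[OF C(1)]] by (intro exI conjI)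
  qed
  have unit: "g (\<iota>\<^sub>\<zeta> X x) = f x" if x: "x \<in> topspace X" for x
  proof (rule ccontr)
    assume ne: "g (\<iota>\<^sub>\<zeta> X x) \<noteq> f x"
    have i: "\<iota>\<^sub>\<zeta> X x \<in> clopen_ultrafilters X" using banaschewski_unit_in[OF x] .
    have "f x \<in> topspace Y" using f x by (auto simp: continuous_map_def)
    then obtain C where C: "C \<in> clopens Y" "f x \<in> C" "g (\<iota>\<^sub>\<zeta> X x) \<notin> C"
      using clopen_separation[OF Y, of "f x" "g (\<iota>\<^sub>\<zeta> X x)"] g(1)[OF i] ne by metis
    then have "pre C \<in> \<iota>\<^sub>\<zeta> X x" using pre x by (auto simp: banaschewski_unit_def pre_def)
    then show False using g(2)[OF i C(1)] C(3) by blast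
  qed
  show ?thesis
  proof (rule ex1I[of _ g])
    show "g \<in> extensional (topspace (\<zeta> X)) \<and> continuous_map (\<zeta> X) Y g \<and>
        (\<forall>x\<in>topspace X. g (\<iota>\<^sub>\<zeta> X x) = f x)"
      using cont unit by (simp add: g_def)
    fix h assume h: "h \<in> extensional (topspace (\<zeta> X)) \<and> continuous_map (\<zeta> X) Y h \<and>
        (\<forall>x\<in>topspace X. h (\<iota>\<^sub>\<zeta> X x) = f x)"
    have "h \<U> = g \<U>" if "\<U> \<in> topspace (\<zeta> X)" for \<U>
      using forall_in_closure_of_eq[of \<U> "\<zeta> X" "\<iota>\<^sub>\<zeta> X ` topspace X" Y h g]
        that h cont unit Y(2) by (force simp: banaschewski_unit_dense)
    then show "h = g" using h by (intro extensionalityI[of h "topspace (\<zeta> X)" g]) (auto simp: g_def)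
  qed
qed

end

theory Submission
  imports Defs
begin

text \<open>
  If \<open>M\<close> is isolated at 0, its norm topology is discrete. Hence a continuous map from the compact
  space \<open>\<zeta> X\<close> to \<open>M\<close> has finite image, and by density of the unit its values on the image of \<open>X\<close>
  are already all of its values; this gives well-definedness, injectivity and the isometry. A
  continuous map on \<open>X\<close> with finite image \<open>F\<close> extends to \<open>\<zeta> X\<close> by the universal property, because
  the finite discrete space \<open>F\<close> is compact, Hausdorff and totally disconnected.
\<close>

text \<open>The distance is translation invariant, so a radius isolating zero isolates every point,
  and all singletons are open.\<close>

lemma norm_topology_discrete:
  assumes M: "banach_module \<C> R nR M nM" and iso: "isolated_at_zero M nM"
  shows "norm_topology M nM = discrete_topology (carrier M)"
proof -
  interpret Module.module R M using M by (simp add: banach_module_def)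
  interpret Metric_space "carrier M" "norm_dist M nM"
    using M by (simp add: banach_module_def banach_group_def complete_norm_def)
  obtain e where e: "e > 0" "mball \<zero>\<^bsub>M\<^esub> e \<subseteq> {\<zero>\<^bsub>M\<^esub>}"
    using iso unfolding isolated_at_zero_def norm_topology_def openin_mtopology by blast
  have "openin mtopology {a}" if a: "a \<in> carrier M" for a
  proof -
    have "mball a e \<subseteq> {a}"
    proof
      fix b assume b: "b \<in> mball a e"
      then have bc: "b \<in> carrier M" by simp
      \<comment> \<open>The distance from zero to \<open>b\<close> minus \<open>a\<close> is the
        norm of zero minus that difference. This identity turns it into the norm that measures the
        distance from \<open>a\<close> to \<open>b\<close>.\<close>
      have "\<zero>\<^bsub>M\<^esub> \<ominus>\<^bsub>M\<^esub> (b \<ominus>\<^bsub>M\<^esub> a) = a \<ominus>\<^bsub>M\<^esub> b"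
        using a bc by (simp add: a_minus_def M.minus_add M.a_comm)
      then have "b \<ominus>\<^bsub>M\<^esub> a \<in> mball \<zero>\<^bsub>M\<^esub> e"
        using a b bc by (simp add: norm_dist_def)
      then have "b \<ominus>\<^bsub>M\<^esub> a = \<zero>\<^bsub>M\<^esub>" using e(2) by blast
      then have "b = \<ominus>\<^bsub>M\<^esub> (\<ominus>\<^bsub>M\<^esub> a)"
        using a bc M.minus_equality[of b "\<ominus>\<^bsub>M\<^esub> a"] by (simp add: a_minus_def)
      then show "b \<in> {a}" using a by simp
    qed
    then show ?thesis using a e(1) by (auto simp: openin_mtopology)
  qed
  then show ?thesis
    using discrete_topology_unique[of "carrier M" mtopology] by (simp add: norm_topology_def)
qed

lemma totally_disconnected_discrete_topology: "totally_disconnected_space (discrete_topology A)"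
  unfolding totally_disconnected_space_def connectedin_discrete_topology by blast

text \<open>The image is a compact subset of a discrete space.\<close>

lemma continuous_map_compact_discrete_finite:
  assumes "compact_space Y" "continuous_map Y (discrete_topology A) f"
  shows "finite (f ` topspace Y)"
  using image_compactin[of Y "topspace Y" "discrete_topology A" f] assms
  by (simp add: compact_space_def compactin_discrete_topology)

text \<open>The points of X are dense in \<zeta>(X), and continuity sends the closure of a set into
  the closure of its image. In a discrete space that image is already closed.\<close>

lemma banaschewski_unit_image:
  assumes f: "continuous_map (\<zeta> X) (discrete_topology A) f"
  shows "f ` \<iota>\<^sub>\<zeta> X ` topspace X = f ` topspace (\<zeta> X)"
proof
  have i: "\<iota>\<^sub>\<zeta> X ` topspace X \<subseteq> topspace (\<zeta> X)"
    using banaschewski_unit_in[of _ X] by (auto simp: topspace_banaschewski)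
  then show "f ` \<iota>\<^sub>\<zeta> X ` topspace X \<subseteq> f ` topspace (\<zeta> X)" by (rule image_mono)
  \<comment> \<open>Closure in \<open>discrete_topology A\<close> is intersection with
    \<open>A\<close>, which changes nothing for subsets of \<open>A\<close>.\<close>
  have "f ` \<iota>\<^sub>\<zeta> X ` topspace X \<subseteq> A"
    using i continuous_map_image_subset_topspace[OF f] by auto
  then show "f ` topspace (\<zeta> X) \<subseteq> f ` \<iota>\<^sub>\<zeta> X ` topspace X"
    using continuous_map_image_closure_subset[OF f, of "\<iota>\<^sub>\<zeta> X ` topspace X"]
    by (auto simp: banaschewski_unit_dense discrete_topology_closure_of)
qed

lemma banaschewski_extension_discrete:
  assumes f: "continuous_map X (discrete_topology A) f" and fin: "finite (f ` topspace X)"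
  obtains g where "g \<in> extensional (topspace (\<zeta> X))"
    "continuous_map (\<zeta> X) (discrete_topology A) g"
    "\<And>x. x \<in> topspace X \<Longrightarrow> g (\<iota>\<^sub>\<zeta> X x) = f x"
proof -
  \<comment> \<open>The universal property asks for a compact target. \<open>A\<close> may be
    infinite, so the finite image takes its place.\<close>
  define F where "F = f ` topspace X"
  have FA: "F \<subseteq> A" using continuous_map_image_subset_topspace[OF f] by (auto simp: F_def)
  \<comment> \<open>Seen as a subspace of \<open>A\<close>, the target can be shrunk to
    \<open>F\<close> for \<open>f\<close> and enlarged back to \<open>A\<close> for the
    extension.\<close>
  have sub: "discrete_topology F = subtopology (discrete_topology A) F"
    using FA by (simp add: subtopology_discrete_topology inf_absorb2)
  have "continuous_map X (discrete_topology F) f"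
    using f unfolding sub continuous_map_in_subtopology by (auto simp: F_def)
  then obtain g where "g \<in> extensional (topspace (\<zeta> X))"
    "continuous_map (\<zeta> X) (subtopology (discrete_topology A) F) g" "\<forall>x\<in>topspace X. g (\<iota>\<^sub>\<zeta> X x) = f x"
    using banaschewski_universal[of "discrete_topology F" X f] fin
    unfolding sub[symmetric]
    by (auto simp: F_def compact_space_discrete_topology Hausdorff_space_discrete_topology
        totally_disconnected_discrete_topology)
  then show thesis using that unfolding continuous_map_in_subtopology by blast
qed

text \<open>Continuous maps into a Hausdorff space that agree on a dense set agree everywhere. This
  is the source of injectivity.\<close>

lemma banaschewski_ext:
  assumes "Hausdorff_space Y" "continuous_map (\<zeta> X) Y f" "continuous_map (\<zeta> X) Y g"
    and "f \<in> extensional (topspace (\<zeta> X))" "g \<in> extensional (topspace (\<zeta> X))"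
    and "\<And>x. x \<in> topspace X \<Longrightarrow> f (\<iota>\<^sub>\<zeta> X x) = g (\<iota>\<^sub>\<zeta> X x)"
  shows "f = g"
proof (rule extensionalityI[OF assms(4,5)])
  fix \<U> assume "\<U> \<in> topspace (\<zeta> X)"
  then show "f \<U> = g \<U>"
    using forall_in_closure_of_eq[of \<U> "\<zeta> X" "\<iota>\<^sub>\<zeta> X ` topspace X" Y f g] assms(1-3,6)
    by (force simp: banaschewski_unit_dense)
qed

theorem proposition3p6:
  fixes \<C> :: banach_category
    and R :: "('r, 's) ring_scheme" and nR :: "'r \<Rightarrow> real"
    and M :: "('r, 'a, 'm) module_scheme" and nM :: "'a \<Rightarrow> real"
    and X :: "'x topology"
  assumes "commutative_monoid_object \<C> R nR"
    and "banach_module \<C> R nR M nM"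
    and "isolated_at_zero M nM"
  shows "banaschewski_pullback X \<in>
           isometric_linear_isos R
             (cont_module (\<zeta> X) M nM) (sup_norm (\<zeta> X) nM)
             (cont_fin_module X M nM) (sup_norm X nM)"
proof -
  have top: "norm_topology M nM = discrete_topology (carrier M)"
    using assms(2,3) by (rule norm_topology_discrete)
  have i: "\<iota>\<^sub>\<zeta> X x \<in> topspace (\<zeta> X)" if "x \<in> topspace X" for x
    using banaschewski_unit_in[OF that] by (simp add: topspace_banaschewski)
  \<comment> \<open>This equality of images serves twice: it transfers finiteness to the pullback,
    and it identifies the two supremum norms.\<close>
  have img: "banaschewski_pullback X f ` topspace X = f ` topspace (\<zeta> X)"
    if "f \<in> carrier (cont_module (\<zeta> X) M nM)" for f
    using that banaschewski_unit_image[of X "carrier M" f]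
    by (simp add: cont_module_eqs top banaschewski_pullback_def image_image)
  have fin: "f \<in> carrier (cont_fin_module X M nM) \<longleftrightarrow>
      f \<in> carrier (cont_module X M nM) \<and> finite (f ` topspace X)" for f
    by (simp add: cont_fin_module_def)
  have ops: "add (cont_fin_module X M nM) = add (cont_module X M nM)"
    "smult (cont_fin_module X M nM) = smult (cont_module X M nM)"
    by (simp_all add: cont_fin_module_def)
  have mem: "banaschewski_pullback X f \<in> carrier (cont_fin_module X M nM)"
    if f: "f \<in> carrier (cont_module (\<zeta> X) M nM)" for f
  proof -
    have c: "continuous_map (\<zeta> X) (norm_topology M nM) f" using f by (simp add: cont_module_eqs)
    have "continuous_map X (norm_topology M nM) (\<lambda>x. f (\<iota>\<^sub>\<zeta> X x))"
      using continuous_map_compose[OF continuous_map_banaschewski_unit c] by (simp add: o_def)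
    moreover have "finite (f ` topspace (\<zeta> X))"
      using continuous_map_compact_discrete_finite[OF compact_banaschewski] c by (simp add: top)
    ultimately show ?thesis
      unfolding fin img[OF f]
      by (simp add: cont_module_eqs banaschewski_pullback_def continuous_map_restrict_eq)
  qed
  \<comment> \<open>The operations are pointwise on \<open>topspace (\<zeta> X)\<close> and
    undefined outside it; \<open>i\<close> ensures that they are evaluated only at points
    inside.\<close>
  have "banaschewski_pullback X \<in> linear_maps R (cont_module (\<zeta> X) M nM) (cont_fin_module X M nM)"
    unfolding linear_maps_def ops
    using mem by (auto simp: cont_module_eqs(2,4) banaschewski_pullback_def i intro!: restrict_ext)
  moreover have "bij_betw (banaschewski_pullback X)
      (carrier (cont_module (\<zeta> X) M nM)) (carrier (cont_fin_module X M nM))"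
  proof (rule bij_betw_imageI)
    show "inj_on (banaschewski_pullback X) (carrier (cont_module (\<zeta> X) M nM))"
    proof (rule inj_onI)
      fix f g
      assume fg: "f \<in> carrier (cont_module (\<zeta> X) M nM)" "g \<in> carrier (cont_module (\<zeta> X) M nM)"
        and eq: "banaschewski_pullback X f = banaschewski_pullback X g"
      have "f (\<iota>\<^sub>\<zeta> X x) = g (\<iota>\<^sub>\<zeta> X x)" if "x \<in> topspace X" for x
        using fun_cong[OF eq, of x] that by (simp add: banaschewski_pullback_def)
      then show "f = g"
        using fg by (intro banaschewski_ext[of "discrete_topology (carrier M)" X f g])
          (simp_all add: cont_module_eqs top Hausdorff_space_discrete_topology)
    qed
    show "banaschewski_pullback X ` carrier (cont_module (\<zeta> X) M nM) =
        carrier (cont_fin_module X M nM)"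
    proof (intro antisym image_subsetI mem subsetI)
      fix f assume f: "f \<in> carrier (cont_fin_module X M nM)"
      then obtain g where g: "g \<in> extensional (topspace (\<zeta> X))"
        "continuous_map (\<zeta> X) (discrete_topology (carrier M)) g"
        "\<And>x. x \<in> topspace X \<Longrightarrow> g (\<iota>\<^sub>\<zeta> X x) = f x"
        using banaschewski_extension_discrete[of X "carrier M" f]
        by (auto simp: fin cont_module_eqs top)
      have "f = banaschewski_pullback X g"
        using f g(3) unfolding fin cont_module_eqs banaschewski_pullback_def
        by (intro extensionalityI[of f "topspace X"]) auto
      moreover have "g \<in> carrier (cont_module (\<zeta> X) M nM)" using g by (simp add: cont_module_eqs top)
      ultimately show "f \<in> banaschewski_pullback X ` carrier (cont_module (\<zeta> X) M nM)" by blast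
    qed
  qed
  moreover have "sup_norm X nM (banaschewski_pullback X f) = sup_norm (\<zeta> X) nM f"
    if "f \<in> carrier (cont_module (\<zeta> X) M nM)" for f
  proof -
    \<comment> \<open>Both suprema are taken over literally the same set of reals.\<close>
    have "(\<lambda>x. nM (banaschewski_pullback X f x)) ` topspace X = (\<lambda>\<U>. nM (f \<U>)) ` topspace (\<zeta> X)"
      using arg_cong[OF img[OF that], of "(`) nM"] by (simp only: image_image)
    then show ?thesis by (simp add: sup_norm_def)
  qed
  ultimately show ?thesis by (simp add: isometric_linear_isos_def)
qed

end
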